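(* Let $V\subset\mathbb{Z}^2$ be a lattice set, let $W$ be a real weight function on $V$, and let $\mathcal{D}$ be a standard second order partial difference operator with polynomial coefficients. If $W$ is consistent with $\mathcal{D}$ and $u,v\in\mathbb{R}[x_1,x_2]$ are polynomials satisfying $\mathcal{D}u=\lambda u$ and $\mathcal{D}v=\mu v$ for real numbers $\lambda,\mu$, then $$(\lambda-\mu)\,\mathcal{L}(uv)=0.$$
   Context: Notation: $e_1=(1,0)$, $e_2=(0,1)$; $\Delta_i u(x)=u(x+e_i)-u(x)$ and $\nabla_i u(x)=u(x)-u(x-e_i)$; $\Pi^2=\mathbb{R}[x_1,x_2]$. A standard second order partial difference operator is $$\mathcal{D}=A_{1,1}\Delta_1\nabla_1+A_{1,2}\Delta_1\nabla_2+A_{2,1}\Delta_2\nabla_1+A_{2,2}\Delta_2\nabla_2+B_1\Delta_1+B_2\Delta_2,$$ with $A_{i,j},B_i\in\Pi^2$. Put $$\mathcal{A}_1=A_{1,1}\nabla_1+A_{1,2}\nabla_2+B_1,\qquad \mathcal{A}_2=A_{2,1}\nabla_1+A_{2,2}\nabla_2+B_2.$$ Weight function: $W:V\to\mathbb{R}$ with $W(x)\neq0$ for all $x\in V$, and, if $V$ is infinite, $\sum_{x\in V}|x_1^ix_2^j||W(x)|<\infty$ for all $(i,j)\in\mathbb{N}_0^2$. Define $\mathcal{L}(f)=\sum_{x\in V}f(x)W(x)$ for $f\in\Pi^2$. $W$ is consistent with $\mathcal{D}$ if for all $g\in\Pi^2$: (1) $\mathcal{L}(\mathcal{A}_1g)=0$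 and $\mathcal{L}(\mathcal{A}_2g)=0$; and (2) $\mathcal{L}(A_{1,2}\,g(\cdot-e_2))=\mathcal{L}(A_{2,1}\,g(\cdot-e_1))$. *)

theory Defs
  imports "HOL-Analysis.Infinite_Sum" "HOL-Computational_Algebra.Polynomial"
begin

(* The ring R[x1,x2] is represented as R[x1][x2]: the coefficients are polynomials in x1,
   and the outer variable is x2. *)
type_synonym poly2 = "real poly poly"

definition eval2 :: "poly2 \<Rightarrow> real \<Rightarrow> real \<Rightarrow> real" where
  "eval2 f x1 x2 = poly (poly f [:x2:]) x1"

(* The polynomial u(x1 + a, x2 + b); see eval2_translate. *)
definition translate :: "real \<Rightarrow> real \<Rightarrow> poly2 \<Rightarrow> poly2" where
  "translate a b u = pcompose (map_poly (\<lambda>c. pcompose c [:a, 1:]) u) [:[:b:], 1:]"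

lemma eval2_translate: "eval2 (translate a b u) x1 x2 = eval2 u (x1 + a) (x2 + b)"
proof -
  have "poly (poly (map_poly (\<lambda>c. pcompose c [:a, 1:]) u) [:z:]) x1 = poly (poly u [:z:]) (x1 + a)"
    for z
    by (induction u) (simp_all add: map_poly_pCons poly_pcompose add.commute)
  then show ?thesis
    by (simp add: eval2_def translate_def poly_pcompose add.commute)
qed

definition \<Delta>\<^sub>1 :: "poly2 \<Rightarrow> poly2" where "\<Delta>\<^sub>1 u = translate 1 0 u - u"
definition \<Delta>\<^sub>2 :: "poly2 \<Rightarrow> poly2" where "\<Delta>\<^sub>2 u = translate 0 1 u - u"
definition nabla\<^sub>1 :: "poly2 \<Rightarrow> poly2" (\<open>\<nabla>\<^sub>1\<close>) where "\<nabla>\<^sub>1 u = u - translate (-1) 0 u"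
definition nabla\<^sub>2 :: "poly2 \<Rightarrow> poly2" (\<open>\<nabla>\<^sub>2\<close>) where "\<nabla>\<^sub>2 u = u - translate 0 (-1) u"

record diff_op =
  A11 :: poly2
  A12 :: poly2
  A21 :: poly2
  A22 :: poly2
  B1 :: poly2
  B2 :: poly2

definition apply_op :: "diff_op \<Rightarrow> poly2 \<Rightarrow> poly2" where
  "apply_op D u =
     A11 D * \<Delta>\<^sub>1 (\<nabla>\<^sub>1 u) + A12 D * \<Delta>\<^sub>1 (\<nabla>\<^sub>2 u) + A21 D * \<Delta>\<^sub>2 (\<nabla>\<^sub>1 u) + A22 D * \<Delta>\<^sub>2 (\<nabla>\<^sub>2 u)
     + B1 D * \<Delta>\<^sub>1 u + B2 D * \<Delta>\<^sub>2 u"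

definition \<A>\<^sub>1 :: "diff_op \<Rightarrow> poly2 \<Rightarrow> poly2" where
  "\<A>\<^sub>1 D g = A11 D * \<nabla>\<^sub>1 g + A12 D * \<nabla>\<^sub>2 g + B1 D * g"

definition \<A>\<^sub>2 :: "diff_op \<Rightarrow> poly2 \<Rightarrow> poly2" where
  "\<A>\<^sub>2 D g = A21 D * \<nabla>\<^sub>1 g + A22 D * \<nabla>\<^sub>2 g + B2 D * g"

(* Only the values of W on V matter. *)
definition weight_function :: "(int \<times> int) set \<Rightarrow> (int \<times> int \<Rightarrow> real) \<Rightarrow> bool" where
  "weight_function V W \<longleftrightarrow>
     (\<forall>x\<in>V. W x \<noteq> 0) \<and>
     (infinite V \<longrightarrow>
       (\<forall>i j :: nat. (\<lambda>x. \<bar>real_of_int (fst x) ^ i * real_of_int (snd x) ^ j\<bar> * \<bar>W x\<bar>) summable_on V))"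

definition \<L> :: "(int \<times> int) set \<Rightarrow> (int \<times> int \<Rightarrow> real) \<Rightarrow> poly2 \<Rightarrow> real" where
  "\<L> V W f = (\<Sum>\<^sub>\<infinity>x\<in>V. eval2 f (real_of_int (fst x)) (real_of_int (snd x)) * W x)"

definition consistent :: "(int \<times> int) set \<Rightarrow> (int \<times> int \<Rightarrow> real) \<Rightarrow> diff_op \<Rightarrow> bool" where
  "consistent V W D \<longleftrightarrow>
     (\<forall>g. \<L> V W (\<A>\<^sub>1 D g) = 0 \<and> \<L> V W (\<A>\<^sub>2 D g) = 0 \<and>
          \<L> V W (A12 D * translate 0 (-1) g) = \<L> V W (A21 D * translate (-1) 0 g))"

end

(* The defect v Du - u Dv of symmetry of D is, with k = (D1 v)(D2 u) - (D1 u)(D2 v) and D_i the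
   forward difference in direction i, equal to
     A_1(v D1 u - u D1 v) + A_2(v D2 u - u D2 v) + A12 k(. - e2) - A21 k(. - e1).
   Consistency says that L annihilates the first two terms and that the last two have the same
   image under L. *)
theory Submission imports Defs begin

lemma eval2_add [simp]: "eval2 (f + g) x y = eval2 f x y + eval2 g x y"
  and eval2_diff [simp]: "eval2 (f - g) x y = eval2 f x y - eval2 g x y"
  and eval2_mult [simp]: "eval2 (f * g) x y = eval2 f x y * eval2 g x y"
  and eval2_smult [simp]: "eval2 (smult p f) x y = poly p x * eval2 f x y"
  by (simp_all add: eval2_def)

text \<open>\<open>weight_function\<close> controls only the moments, so sums over \<open>V\<close>
  are reduced to monomials.\<close>

lemma eval2_altdef:
  "eval2 f x y = (\<Sum>j\<le>degree f. \<Sum>i\<le>degree (coeff f j). coeff (coeff f j) i * (x ^ i * y ^ j))"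
  by (simp add: eval2_def poly_altdef[of f] poly_altdef[of "coeff f _"] poly_sum poly_power
      sum_distrib_right mult.assoc)

lemma summable_on_sum:
  fixes f :: "'i \<Rightarrow> 'a \<Rightarrow> 'b :: {topological_comm_monoid_add, t2_space}"
  assumes "\<And>i. i \<in> I \<Longrightarrow> f i summable_on A"
  shows "(\<lambda>x. \<Sum>i\<in>I. f i x) summable_on A"
  using assms by (induction I rule: infinite_finite_induct) (auto intro: summable_on_add)

lemma summable_on_eval2:
  assumes "weight_function V W"
  shows "(\<lambda>x. eval2 f (real_of_int (fst x)) (real_of_int (snd x)) * W x) summable_on V"
proof (cases "finite V")
  case False
  have mono: "(\<lambda>x. real_of_int (fst x) ^ i * real_of_int (snd x) ^ j * W x) summable_on V" for i j
    using assms False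
    \<comment> \<open>Summability over a set is unconditional, so for reals it amounts to the
      absolute summability in \<open>weight_function\<close>.\<close>
    by (subst summable_on_iff_abs_summable_on_real) (simp add: weight_function_def abs_mult)
  have "(\<lambda>x. \<Sum>j\<le>degree f. \<Sum>i\<le>degree (coeff f j).
      coeff (coeff f j) i * (real_of_int (fst x) ^ i * real_of_int (snd x) ^ j * W x)) summable_on V"
    by (intro summable_on_sum summable_on_cmult_right mono)
  then show ?thesis
    by (simp add: eval2_altdef sum_distrib_right mult.assoc)
qed (rule summable_on_finite)

lemma \<L>_add: "weight_function V W \<Longrightarrow> \<L> V W (f + g) = \<L> V W f + \<L> V W g"
  by (simp add: \<L>_def ring_distribs infsum_add summable_on_eval2)

text \<open>Unlike addition, scaling respects the default value 0 that \<open>infsum\<close> takes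
  on a divergent family.\<close>

lemma \<L>_smult: "\<L> V W (smult [:c:] f) = c * \<L> V W f"
  by (simp add: \<L>_def mult.assoc infsum_cmult_right')

lemma \<L>_diff: "weight_function V W \<Longrightarrow> \<L> V W (f - g) = \<L> V W f - \<L> V W g"
  using \<L>_add[of V W "f - g" g] by simp

lemma \<L>_cong: "(\<And>x y. eval2 f x y = eval2 g x y) \<Longrightarrow> \<L> V W f = \<L> V W g"
  by (simp add: \<L>_def)

text \<open>Put w = D_j u in the product rule v nabla_i w = nabla_i (v w) - (nabla_i v) w(. - e_i)
  and antisymmetrise in u and v. The correction terms cancel for i = j and give k(. - e_i) up to
  sign otherwise.\<close>

lemma eval2_symmetry_defect:
  fixes D :: diff_op and u v :: poly2
  defines "k \<equiv> \<Delta>\<^sub>1 v * \<Delta>\<^sub>2 u - \<Delta>\<^sub>1 u * \<Delta>\<^sub>2 v"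
  shows "eval2 (v * apply_op D u - u * apply_op D v) x y =
    eval2 (\<A>\<^sub>1 D (v * \<Delta>\<^sub>1 u - u * \<Delta>\<^sub>1 v) + \<A>\<^sub>2 D (v * \<Delta>\<^sub>2 u - u * \<Delta>\<^sub>2 v)
      + (A12 D * translate 0 (-1) k - A21 D * translate (-1) 0 k)) x y"
  unfolding k_def apply_op_def \<A>\<^sub>1_def \<A>\<^sub>2_def \<Delta>\<^sub>1_def \<Delta>\<^sub>2_def nabla\<^sub>1_def nabla\<^sub>2_def
  \<comment> \<open>Shifts become values at neighbouring points, which leaves an identity in a
    commutative ring.\<close>
  by (simp add: eval2_translate) (simp add: algebra_simps)

theorem theorem3p7:
  fixes V :: "(int \<times> int) set" and W :: "int \<times> int \<Rightarrow> real"
    and D :: diff_op and u v :: poly2 and lam mu :: real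
  assumes "weight_function V W"
    and "consistent V W D"
    and "apply_op D u = smult [:lam:] u"
    and "apply_op D v = smult [:mu:] v"
  shows "(lam - mu) * \<L> V W (u * v) = 0"
proof -
  have "\<L> V W (v * apply_op D u - u * apply_op D v) = 0"
    using assms(1,2)
    by (simp add: \<L>_cong[OF eval2_symmetry_defect] \<L>_add \<L>_diff consistent_def)
  \<comment> \<open>The eigenvalue equations turn the defect into lam v u - mu u v.\<close>
  then show ?thesis
    using assms by (simp add: \<L>_diff \<L>_smult mult.commute[of v u] left_diff_distrib)
qed

end
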